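(* Suppose that $\nabla f$ is Lipschitz continuous with constant $L_f>0$, that $h$ is proper, closed and convex, that $F=f+h$ is bounded below, and that $f$ is $\mu$-strongly convex with $\mu>0$. Let $\{x_k\}_{k\ge0}\subset\mathbb{R}^n$ be a sequence of iterates with $s_k:=x_{k+1}-x_k$, let $\{\Delta_k\}_{k\ge0}$ be positive sampling radii, and let $y^{\mathrm{FD}}_{k-1}:=g^{\mathrm{FD}}_k-g^{\mathrm{FD}}_{k-1}$, where $g^{\mathrm{FD}}_k$ is the forward-difference gradient estimate of $f$ at $x_k$ with radius $\Delta_k$. If $$\Delta_k<\frac{\mu}{\sqrt n\,L_f}\min\{\|s_{k-1}\|,\|s_k\|\}$$ for all $k$, then $(y^{\mathrm{FD}}_{k-1})^\top s_{k-1}>0$ (for every $k\ge1$).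
   Context: $f:\mathbb{R}^n\to\mathbb{R}$ is continuously differentiable, $h:\mathbb{R}^n\to\mathbb{R}\cup\{+\infty\}$, and $\|\cdot\|$ is the Euclidean norm. The forward-difference estimate is $$g^{\mathrm{FD}}_k:=\sum_{i=1}^n\frac{f(x_k+\Delta_ke_i)-f(x_k)}{\Delta_k}e_i,$$ where $e_1,\dots,e_n$ is the canonical basis of $\mathbb{R}^n$. For $k=0$ the minimum in the condition on $\Delta_k$ is read as $\|s_0\|$. *)

theory Defs
  imports "HOL-Analysis.Analysis"
begin

definition strongly_convex_on :: "real \<Rightarrow> 'a::real_normed_vector set \<Rightarrow> ('a \<Rightarrow> real) \<Rightarrow> bool" where
  "strongly_convex_on \<mu> S f \<longleftrightarrow> convex S \<and>
     (\<forall>x\<in>S. \<forall>y\<in>S. \<forall>t\<in>{0..1}.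
        f ((1 - t) *\<^sub>R x + t *\<^sub>R y)
          \<le> (1 - t) * f x + t * f y - \<mu> / 2 * t * (1 - t) * (norm (x - y))\<^sup>2)"

text \<open>Functions into \<open>\<real> \<union> {+\<infinity>}\<close> are modelled as \<open>ereal\<close>-valued functions; \<open>proper_fun\<close> excludes
  the value \<open>-\<infinity>\<close>. The epigraph keeps real second components, so that convexity makes sense in the
  vector space \<open>'a \<times> real\<close>; \<open>epigraph\<close> of the library covers real-valued functions only.\<close>

definition proper_fun :: "('a \<Rightarrow> ereal) \<Rightarrow> bool" where
  "proper_fun h \<longleftrightarrow> (\<forall>x. h x \<noteq> -\<infinity>) \<and> (\<exists>x. h x \<noteq> \<infinity>)"

definition ereal_epigraph :: "('a \<Rightarrow> ereal) \<Rightarrow> ('a \<times> real) set" where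
  "ereal_epigraph h = {(x, r). h x \<le> ereal r}"

definition closed_fun :: "('a::topological_space \<Rightarrow> ereal) \<Rightarrow> bool" where
  "closed_fun h \<longleftrightarrow> closed (ereal_epigraph h)"

definition convex_fun :: "('a::real_vector \<Rightarrow> ereal) \<Rightarrow> bool" where
  "convex_fun h \<longleftrightarrow> convex (ereal_epigraph h)"

definition fd_gradient :: "(real ^ 'n \<Rightarrow> real) \<Rightarrow> real ^ 'n \<Rightarrow> real \<Rightarrow> real ^ 'n" where
  "fd_gradient f x \<delta> =
     (\<Sum>i\<in>UNIV. ((f (x + \<delta> *\<^sub>R axis i 1) - f x) / \<delta>) *\<^sub>R axis i 1)"

end

theory Submission
  imports Defs
begin

text \<open>A strongly convex function has a strongly monotone gradient, so that
  \<open>(\<nabla>f(x\<^sub>k) - \<nabla>f(x\<^sub>k\<^sub>-\<^sub>1)) \<bullet> s\<^sub>k\<^sub>-\<^sub>1\<close> is at least \<open>\<mu> \<parallel>s\<^sub>k\<^sub>-\<^sub>1\<parallel>\<^sup>2\<close> (lemma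
  \<open>strongly_convex_gradient_monotone\<close>). When the gradient is \<open>L\<close>-Lipschitz, the forward-difference
  estimate with radius \<open>\<delta>\<close> differs from the gradient by at most \<open>sqrt n L \<delta> / 2\<close> (lemma
  \<open>fd_gradient_error\<close>). Replacing both gradients by their estimates therefore changes the inner
  product by at most \<open>sqrt n L (\<Delta>\<^sub>k + \<Delta>\<^sub>k\<^sub>-\<^sub>1) \<parallel>s\<^sub>k\<^sub>-\<^sub>1\<parallel> / 2\<close>. The step \<open>s\<^sub>k\<^sub>-\<^sub>1\<close> occurs in the bounds
  on both \<open>\<Delta>\<^sub>k\<close> and \<open>\<Delta>\<^sub>k\<^sub>-\<^sub>1\<close>, and these make the change strictly smaller than
  \<open>\<mu> \<parallel>s\<^sub>k\<^sub>-\<^sub>1\<parallel>\<^sup>2\<close>. The factor \<open>1/2\<close> in the error bound is essential here, because two errors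
  are added.\<close>

lemma GDERIV_along_line:
  fixes f :: "'a::real_inner \<Rightarrow> real"
  assumes "GDERIV f (x + t *\<^sub>R v) :> D"
  shows "((\<lambda>t. f (x + t *\<^sub>R v)) has_real_derivative v \<bullet> D) (at t)"
proof -
  have 1: "(f has_derivative (\<lambda>h. h \<bullet> D)) (at (x + t *\<^sub>R v))"
    using assms by (simp add: gderiv_def)
  have 2: "((\<lambda>t. x + t *\<^sub>R v) has_derivative (\<lambda>h. h *\<^sub>R v)) (at t)"
    by (auto intro!: derivative_eq_intros)
  have "((\<lambda>t. f (x + t *\<^sub>R v)) has_derivative (\<lambda>h. (h *\<^sub>R v) \<bullet> D)) (at t)"
    using has_derivative_compose[OF 2 1] .
  then show ?thesis
    by (simp add: has_field_derivative_def mult_commute_abs)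
qed

lemma Lipschitz_gradient_upper_bound:
  fixes f :: "'a::real_inner \<Rightarrow> real"
  assumes grad: "\<And>z. GDERIV f z :> g z" and lip: "L-lipschitz_on UNIV g"
  shows "f (x + v) - f x - v \<bullet> g x \<le> L / 2 * (norm v)\<^sup>2"
proof -
  \<comment> \<open>The claim is \<open>\<phi> 1 \<le> \<phi> 0\<close>; by the Lipschitz bound, \<open>\<phi>\<close> has a nonpositive derivative
    on \<open>[0, 1]\<close>.\<close>
  define \<phi> where "\<phi> t = f (x + t *\<^sub>R v) - t * (v \<bullet> g x) - L / 2 * t\<^sup>2 * (norm v)\<^sup>2" for t
  have "\<phi> 1 \<le> \<phi> 0"
  proof (rule DERIV_nonpos_imp_nonincreasing[of 0 1])
    fix t :: real
    assume t: "0 \<le> t" "t \<le> 1"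
    let ?d = "v \<bullet> g (x + t *\<^sub>R v) - v \<bullet> g x - L * t * (norm v)\<^sup>2"
    have "(\<phi> has_real_derivative ?d) (at t)"
      unfolding \<phi>_def
      by (rule derivative_eq_intros GDERIV_along_line[OF grad] refl | simp)+
    moreover have "?d \<le> 0"
    proof -
      have "v \<bullet> (g (x + t *\<^sub>R v) - g x) \<le> norm v * norm (g (x + t *\<^sub>R v) - g x)"
        by (rule norm_cauchy_schwarz)
      also have "\<dots> \<le> norm v * (L * (t * norm v))"
        using lipschitz_onD[OF lip, of "x + t *\<^sub>R v" x] t
        by (intro mult_left_mono) (auto simp: dist_norm)
      finally show ?thesis
        by (simp add: inner_diff_right power2_eq_square algebra_simps)
    qed
    ultimately show "\<exists>y. (\<phi> has_real_derivative y) (at t) \<and> y \<le> 0"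
      by blast
  qed simp
  then show ?thesis
    by (simp add: \<phi>_def)
qed

lemma Lipschitz_gradient_linearization_error:
  fixes f :: "'a::real_inner \<Rightarrow> real"
  assumes grad: "\<And>z. GDERIV f z :> g z" and lip: "L-lipschitz_on UNIV g"
  shows "\<bar>f (x + v) - f x - v \<bullet> g x\<bar> \<le> L / 2 * (norm v)\<^sup>2"
proof -
  have "GDERIV (\<lambda>z. - f z) z :> - g z" for z
    using GDERIV_minus[OF grad] .
  moreover have "L-lipschitz_on UNIV (\<lambda>z. - g z)"
    using lip by (simp add: lipschitz_on_minus)
  ultimately show ?thesis
    unfolding abs_le_iff
    using Lipschitz_gradient_upper_bound[OF grad lip, of x v]
      Lipschitz_gradient_upper_bound[of "\<lambda>z. - f z" "\<lambda>z. - g z" L x v]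
    by simp
qed

lemma norm_vec_le_sqrt_card:
  fixes v :: "real ^ 'n"
  assumes "\<And>i. \<bar>v $ i\<bar> \<le> b"
  shows "norm v \<le> sqrt (real CARD('n)) * b"
proof -
  have "0 \<le> b"
    using assms[of undefined] by simp
  have "norm v \<le> L2_set (\<lambda>_. b) (UNIV :: 'n set)"
    unfolding norm_vec_def using assms by (intro L2_set_mono) auto
  also have "\<dots> = sqrt (real CARD('n)) * b"
    using \<open>0 \<le> b\<close> by (simp add: L2_set_def real_sqrt_mult)
  finally show ?thesis .
qed

lemma fd_gradient_nth:
  "fd_gradient f x \<delta> $ i = (f (x + \<delta> *\<^sub>R axis i 1) - f x) / \<delta>"
  by (simp add: fd_gradient_def axis_def if_distrib cong: if_cong)

lemma fd_gradient_error:
  fixes f :: "real ^ 'n \<Rightarrow> real"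
  assumes grad: "\<And>z. GDERIV f z :> g z" and lip: "L-lipschitz_on UNIV g" and "\<delta> > 0"
  shows "norm (fd_gradient f x \<delta> - g x) \<le> sqrt (real CARD('n)) * (L * \<delta> / 2)"
proof (rule norm_vec_le_sqrt_card)
  fix i :: 'n
  have "\<bar>f (x + \<delta> *\<^sub>R axis i 1) - f x - \<delta> * g x $ i\<bar> \<le> L / 2 * \<delta>\<^sup>2"
    using Lipschitz_gradient_linearization_error[OF grad lip, of x "\<delta> *\<^sub>R axis i 1"] \<open>\<delta> > 0\<close>
    by (simp add: inner_axis')
  moreover have "(fd_gradient f x \<delta> - g x) $ i
      = (f (x + \<delta> *\<^sub>R axis i 1) - f x - \<delta> * g x $ i) / \<delta>"
    using \<open>\<delta> > 0\<close> by (simp add: fd_gradient_nth field_simps)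
  ultimately have "\<bar>(fd_gradient f x \<delta> - g x) $ i\<bar> \<le> L / 2 * \<delta>\<^sup>2 / \<delta>"
    using \<open>\<delta> > 0\<close> by (simp only: abs_divide abs_of_pos divide_right_mono less_imp_le)
  then show "\<bar>(fd_gradient f x \<delta> - g x) $ i\<bar> \<le> L * \<delta> / 2"
    using \<open>\<delta> > 0\<close> by (simp add: power2_eq_square)
qed

text \<open>Strong convexity along the segment from \<open>x\<close> to \<open>y\<close> bounds the difference quotient of \<open>f\<close>
  at \<open>x\<close>; the claim is the limit of this bound as the parameter tends to \<open>0\<close> from above.\<close>

lemma strongly_convex_gradient_lower_bound:
  fixes f :: "'a::real_inner \<Rightarrow> real"
  assumes conv: "strongly_convex_on \<mu> UNIV f" and grad: "GDERIV f x :> D"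
  shows "f x + (y - x) \<bullet> D + \<mu> / 2 * (norm (y - x))\<^sup>2 \<le> f y"
proof -
  define q where "q t = (f (x + t *\<^sub>R (y - x)) - f x) / t" for t
  have "((\<lambda>t. f (x + t *\<^sub>R (y - x))) has_real_derivative (y - x) \<bullet> D) (at 0)"
    using grad by (intro GDERIV_along_line) simp
  then have "(q \<longlongrightarrow> (y - x) \<bullet> D) (at_right 0)"
    unfolding q_def has_field_derivative_iff
    by (auto intro: tendsto_within_subset)
  moreover have "((\<lambda>t. f y - f x - \<mu> / 2 * (1 - t) * (norm (x - y))\<^sup>2)
      \<longlongrightarrow> f y - f x - \<mu> / 2 * (1 - 0) * (norm (x - y))\<^sup>2) (at_right 0)"
    by (intro tendsto_intros)
  moreover have "eventually (\<lambda>t. q t \<le> f y - f x - \<mu> / 2 * (1 - t) * (norm (x - y))\<^sup>2) (at_right 0)"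
    using eventually_at_right_less[of 0] eventually_at_right_real[of 0 1, simplified]
  proof eventually_elim
    case (elim t)
    then have "f ((1 - t) *\<^sub>R x + t *\<^sub>R y)
        \<le> (1 - t) * f x + t * f y - \<mu> / 2 * t * (1 - t) * (norm (x - y))\<^sup>2"
      using conv by (simp add: strongly_convex_on_def)
    moreover have "(1 - t) *\<^sub>R x + t *\<^sub>R y = x + t *\<^sub>R (y - x)"
      by (simp add: algebra_simps)
    ultimately have "f (x + t *\<^sub>R (y - x)) - f x
        \<le> (f y - f x - \<mu> / 2 * (1 - t) * (norm (x - y))\<^sup>2) * t"
      by (simp add: algebra_simps)
    then show ?case
      unfolding q_def using elim by (simp add: pos_divide_le_eq)
  qed
  ultimately have "(y - x) \<bullet> D \<le> f y - f x - \<mu> / 2 * (1 - 0) * (norm (x - y))\<^sup>2"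
    by (intro tendsto_le[OF trivial_limit_at_right_real])
  then show ?thesis
    by (simp add: norm_minus_commute)
qed

lemma strongly_convex_gradient_monotone:
  fixes f :: "'a::real_inner \<Rightarrow> real"
  assumes "strongly_convex_on \<mu> UNIV f" and "\<And>z. GDERIV f z :> g z"
  shows "(g y - g x) \<bullet> (y - x) \<ge> \<mu> * (norm (y - x))\<^sup>2"
  using strongly_convex_gradient_lower_bound[OF assms, of x y]
    strongly_convex_gradient_lower_bound[OF assms, of y x]
  by (simp add: inner_diff_left inner_diff_right inner_commute norm_minus_commute)

theorem theorem6p1:
  fixes f :: "real ^ 'n \<Rightarrow> real"
    and gradf :: "real ^ 'n \<Rightarrow> real ^ 'n"
    and h F :: "real ^ 'n \<Rightarrow> ereal"
    and L\<^sub>f \<mu> :: real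
    and x s g y :: "nat \<Rightarrow> real ^ 'n"
    and \<Delta> :: "nat \<Rightarrow> real"
  assumes gradient: "\<And>z. GDERIV f z :> gradf z"
    and cont_gradient: "continuous_on UNIV gradf"
    and L_pos: "L\<^sub>f > 0"
    and lipschitz_gradient: "L\<^sub>f-lipschitz_on UNIV gradf"
    and h_proper: "proper_fun h"
    and h_closed: "closed_fun h"
    and h_convex: "convex_fun h"
    and F_eq: "\<And>z. F z = ereal (f z) + h z"
    and F_bdd_below: "\<exists>m::real. \<forall>z. ereal m \<le> F z"
    and mu_pos: "\<mu> > 0"
    and f_strongly_convex: "strongly_convex_on \<mu> UNIV f"
    and s_eq: "\<And>k. s k = x (Suc k) - x k"
    and Delta_pos: "\<And>k. \<Delta> k > 0"
    and g_eq: "\<And>k. g k = fd_gradient f (x k) (\<Delta> k)"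
    and y_eq: "\<And>k. k \<ge> 1 \<Longrightarrow> y (k - 1) = g k - g (k - 1)"
    and Delta_less: "\<And>k. \<Delta> k < \<mu> / (sqrt (real CARD('n)) * L\<^sub>f) *
          (if k = 0 then norm (s 0) else min (norm (s (k - 1))) (norm (s k)))"
  shows "\<forall>k\<ge>1. y (k - 1) \<bullet> s (k - 1) > 0"
proof (intro allI impI)
  fix k :: nat
  assume "k \<ge> 1"
  then obtain j where k: "k = Suc j"
    by (cases k) auto
  define c where "c = sqrt (real CARD('n)) * L\<^sub>f"
  define e where "e i = g i - gradf (x i)" for i
  have c_pos: "c > 0"
    using L_pos by (simp add: c_def)
  have Delta_bound: "c * \<Delta> i < \<mu> * norm (s j)" if "i = j \<or> i = Suc j" for i
  proof -
    have "(if i = 0 then norm (s 0) else min (norm (s (i - 1))) (norm (s i))) \<le> norm (s j)"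
      using that by auto
    then have "\<mu> / c * (if i = 0 then norm (s 0) else min (norm (s (i - 1))) (norm (s i)))
        \<le> \<mu> / c * norm (s j)"
      using mu_pos c_pos by (intro mult_left_mono) auto
    then have "\<Delta> i < \<mu> / c * norm (s j)"
      using Delta_less[of i] unfolding c_def by linarith
    then show ?thesis
      using c_pos by (simp add: field_simps)
  qed
  \<comment> \<open>A zero step would force a nonpositive radius.\<close>
  have s_pos: "norm (s j) > 0"
  proof -
    have "0 < \<mu> * norm (s j)"
      using Delta_bound[of j] mult_pos_pos[OF c_pos Delta_pos[of j]] by simp
    then show ?thesis
      using mu_pos by (simp add: zero_less_mult_iff)
  qed
  have error: "norm (e i) \<le> c * \<Delta> i / 2" for i
    using fd_gradient_error[OF gradient lipschitz_gradient Delta_pos, of "x i" i]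
    by (simp add: e_def c_def g_eq)
  have "norm (e (Suc j) - e j) \<le> norm (e (Suc j)) + norm (e j)"
    by (rule norm_triangle_ineq4)
  also have "\<dots> < \<mu> * norm (s j)"
    using error[of j] error[of "Suc j"] Delta_bound[of j] Delta_bound[of "Suc j"] by simp
  finally have "norm (e (Suc j) - e j) * norm (s j) < \<mu> * norm (s j) * norm (s j)"
    using s_pos by (rule mult_strict_right_mono)
  then have "\<bar>(e (Suc j) - e j) \<bullet> s j\<bar> < \<mu> * (norm (s j))\<^sup>2"
    using Cauchy_Schwarz_ineq2[of "e (Suc j) - e j" "s j"]
    by (simp add: power2_eq_square mult.assoc)
  moreover have "(gradf (x (Suc j)) - gradf (x j)) \<bullet> s j \<ge> \<mu> * (norm (s j))\<^sup>2"
    using strongly_convex_gradient_monotone[OF f_strongly_convex gradient] by (simp add: s_eq)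
  moreover have "y j = (gradf (x (Suc j)) - gradf (x j)) + (e (Suc j) - e j)"
    using y_eq[of "Suc j"] by (simp add: e_def)
  ultimately show "y (k - 1) \<bullet> s (k - 1) > 0"
    by (simp add: k inner_add_left)
qed

end
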